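(* Let $x$ be an algebraic complex number of the form $x=e^{te^{-t}}$ where $t\in\mathbb{C}$ satisfies $|t|<1$ or $t$ is a root of unity, so that the iterated exponential sequence $x,\ x^x,\ x^{x^x},\ldots$ converges to $h(x)=e^{t}$. If $h(x)$ is algebraic, then $x$ is a positive real number.
   Context: For $x=e^{te^{-t}}$, powers $x^y$ are defined by $x^y:=e^{y\,te^{-t}}$; with this convention (Baker–Rippon) the sequence $x,\ x^x,\ x^{x^x},\ldots$ converges to $e^t$ whenever $|t|<1$ or $t$ is a root of unity, and $h(x)$ denotes this limit. *)

theory Defs
  imports "HOL-Analysis.Analysis" "HOL-Computational_Algebra.Polynomial"
begin

end

theory Submission
  imports Defs "HOL-Complex_Analysis.Complex_Analysis" "Jordan_Normal_Form.Char_Poly"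
begin

text \<open>
  Writing \<open>\<beta> = exp (- t)\<close>, which is algebraic because \<open>exp t\<close> is, we have \<open>x = exp (\<beta> * t)\<close>.
  By the Gelfond--Schneider theorem \<open>\<beta>\<close> is rational, so \<open>Im t\<close> is a multiple of \<open>\<pi>\<close>; as
  \<open>norm t \<le> 1\<close>, \<open>t\<close> is real.

  The Gelfond--Schneider theorem is proved by Gelfond's method. Siegel's lemma yields an exponential
  sum \<open>f z = (\<Sum>a b. c a b * exp ((a + b * \<beta>) * t * z))\<close> with small integer coefficients vanishing to
  high order at \<open>1, \<dots>, m\<close>. At the first order \<open>r\<close> where some derivative there does not vanish,
  up to factors \<open>C ^ r\<close> the Schwarz lemma bounds that derivative from above by \<open>r powr ((3 - m) * r / 2)\<close>,
  whereas arithmetic bounds it from below by \<open>r powr (- d * r)\<close>, with \<open>d\<close> independent of \<open>m\<close>.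

  Number fields are avoided: an algebraic number is handled through an integer matrix of which it is
  an eigenvalue, all such matrices having one common eigenvector. The lower bound holds since the
  product of the nonzero eigenvalues of an integer matrix is a nonzero integer.
\<close>

section \<open>Algebraic numbers as eigenvalues of integer matrices\<close>

text \<open>Bounding absolute row sums rather than entries makes the bounds submultiplicative.\<close>

definition int_rep :: "'i set \<Rightarrow> ('i \<Rightarrow> complex) \<Rightarrow> real \<Rightarrow> complex \<Rightarrow> bool" where
  "int_rep I v H \<xi> \<longleftrightarrow> (\<exists>M :: 'i \<Rightarrow> 'i \<Rightarrow> int. \<forall>i\<in>I.
     (\<Sum>j\<in>I. \<bar>real_of_int (M i j)\<bar>) \<le> H \<and> \<xi> * v i = (\<Sum>j\<in>I. of_int (M i j) * v j))"

lemma int_repE: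
  assumes "int_rep I v H \<xi>"
  obtains M :: "'i \<Rightarrow> 'i \<Rightarrow> int" where "\<And>i. i \<in> I \<Longrightarrow> (\<Sum>j\<in>I. \<bar>real_of_int (M i j)\<bar>) \<le> H"
    "\<And>i. i \<in> I \<Longrightarrow> \<xi> * v i = (\<Sum>j\<in>I. of_int (M i j) * v j)"
  using assms unfolding int_rep_def by blast

lemma int_repI:
  fixes M :: "'i \<Rightarrow> 'i \<Rightarrow> int"
  assumes "\<And>i. i \<in> I \<Longrightarrow> (\<Sum>j\<in>I. \<bar>real_of_int (M i j)\<bar>) \<le> H"
    "\<And>i. i \<in> I \<Longrightarrow> \<xi> * v i = (\<Sum>j\<in>I. of_int (M i j) * v j)"
  shows "int_rep I v H \<xi>"
  using assms unfolding int_rep_def by blast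

section \<open>Ring operations on numbers sharing one eigenvector\<close>

lemma int_rep_mono: "int_rep I v H \<xi> \<Longrightarrow> H \<le> H' \<Longrightarrow> int_rep I v H' \<xi>"
  unfolding int_rep_def by (meson order_trans)

lemma int_rep_of_int:
  assumes "finite I"
  shows "int_rep I v \<bar>of_int a\<bar> (of_int a)"
proof (rule int_repI[where M = "\<lambda>i j. if i = j then a else 0"])
  fix i assume i: "i \<in> I"
  have "(\<Sum>j\<in>I. \<bar>real_of_int (if i = j then a else 0)\<bar>) = (\<Sum>j\<in>I. if i = j then \<bar>of_int a\<bar> else 0)"
    by (intro sum.cong) auto
  also have "\<dots> = \<bar>of_int a\<bar>" using assms i by simp
  finally show "(\<Sum>j\<in>I. \<bar>real_of_int (if i = j then a else 0)\<bar>) \<le> \<bar>of_int a\<bar>" by simp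
  have "(\<Sum>j\<in>I. of_int (if i = j then a else 0) * v j) = (\<Sum>j\<in>I. if i = j then of_int a * v j else 0)"
    by (intro sum.cong) auto
  also have "\<dots> = of_int a * v i" using assms i by simp
  finally show "of_int a * v i = (\<Sum>j\<in>I. of_int (if i = j then a else 0) * v j)" by simp
qed

lemma int_rep_add:
  assumes "int_rep I v H \<xi>" "int_rep I v G \<eta>"
  shows "int_rep I v (H + G) (\<xi> + \<eta>)"
proof -
  from assms(1) obtain M :: "'a \<Rightarrow> 'a \<Rightarrow> int"
    where M: "\<And>i. i \<in> I \<Longrightarrow> (\<Sum>j\<in>I. \<bar>real_of_int (M i j)\<bar>) \<le> H"
    "\<And>i. i \<in> I \<Longrightarrow> \<xi> * v i = (\<Sum>j\<in>I. of_int (M i j) * v j)" by (rule int_repE) blast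
  from assms(2) obtain N :: "'a \<Rightarrow> 'a \<Rightarrow> int"
    where N: "\<And>i. i \<in> I \<Longrightarrow> (\<Sum>j\<in>I. \<bar>real_of_int (N i j)\<bar>) \<le> G"
    "\<And>i. i \<in> I \<Longrightarrow> \<eta> * v i = (\<Sum>j\<in>I. of_int (N i j) * v j)" by (rule int_repE) blast
  show ?thesis
  proof (rule int_repI[where M = "\<lambda>i j. M i j + N i j"])
    fix i assume i: "i \<in> I"
    have "(\<Sum>j\<in>I. \<bar>real_of_int (M i j + N i j)\<bar>) \<le> (\<Sum>j\<in>I. \<bar>real_of_int (M i j)\<bar> + \<bar>real_of_int (N i j)\<bar>)"
      by (intro sum_mono) auto
    also have "\<dots> \<le> H + G" using M(1)[OF i] N(1)[OF i] by (simp add: sum.distrib)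
    finally show "(\<Sum>j\<in>I. \<bar>real_of_int (M i j + N i j)\<bar>) \<le> H + G" .
    show "(\<xi> + \<eta>) * v i = (\<Sum>j\<in>I. of_int (M i j + N i j) * v j)"
      using M(2)[OF i] N(2)[OF i] by (simp add: distrib_right sum.distrib)
  qed
qed

text \<open>The matrix product \<open>M N\<close> acts on the common eigenvector \<open>v\<close> as
  \<xi> * \<eta>, and its absolute row sums are at most the product of the two bounds.\<close>

lemma int_rep_mult:
  assumes "int_rep I v H \<xi>" "int_rep I v G \<eta>" "0 \<le> G"
  shows "int_rep I v (H * G) (\<xi> * \<eta>)"
proof -
  from assms(1) obtain M :: "'a \<Rightarrow> 'a \<Rightarrow> int"
    where M: "\<And>i. i \<in> I \<Longrightarrow> (\<Sum>j\<in>I. \<bar>real_of_int (M i j)\<bar>) \<le> H"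
    "\<And>i. i \<in> I \<Longrightarrow> \<xi> * v i = (\<Sum>j\<in>I. of_int (M i j) * v j)" by (rule int_repE) blast
  from assms(2) obtain N :: "'a \<Rightarrow> 'a \<Rightarrow> int"
    where N: "\<And>i. i \<in> I \<Longrightarrow> (\<Sum>j\<in>I. \<bar>real_of_int (N i j)\<bar>) \<le> G"
    "\<And>i. i \<in> I \<Longrightarrow> \<eta> * v i = (\<Sum>j\<in>I. of_int (N i j) * v j)" by (rule int_repE) blast
  show ?thesis
  proof (rule int_repI[where M = "\<lambda>i j. \<Sum>k\<in>I. M i k * N k j"])
    fix i assume i: "i \<in> I"
    have "(\<Sum>j\<in>I. \<bar>real_of_int (\<Sum>k\<in>I. M i k * N k j)\<bar>)
        \<le> (\<Sum>j\<in>I. \<Sum>k\<in>I. \<bar>real_of_int (M i k)\<bar> * \<bar>real_of_int (N k j)\<bar>)"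
      unfolding of_int_sum of_int_mult abs_mult[symmetric] by (intro sum_mono sum_abs)
    also have "\<dots> = (\<Sum>k\<in>I. \<bar>real_of_int (M i k)\<bar> * (\<Sum>j\<in>I. \<bar>real_of_int (N k j)\<bar>))"
      by (subst sum.swap) (simp add: sum_distrib_left)
    also have "\<dots> \<le> (\<Sum>k\<in>I. \<bar>real_of_int (M i k)\<bar> * G)"
      using N(1) by (intro sum_mono mult_left_mono) auto
    also have "\<dots> \<le> H * G"
      using M(1)[OF i] assms(3) by (simp add: sum_distrib_right[symmetric] mult_right_mono)
    finally show "(\<Sum>j\<in>I. \<bar>real_of_int (\<Sum>k\<in>I. M i k * N k j)\<bar>) \<le> H * G" .
    have "(\<xi> * \<eta>) * v i = \<eta> * (\<Sum>k\<in>I. of_int (M i k) * v k)"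
      using M(2)[OF i] by (simp add: mult_ac)
    also have "\<dots> = (\<Sum>k\<in>I. of_int (M i k) * (\<eta> * v k))"
      by (simp add: sum_distrib_left mult_ac)
    also have "\<dots> = (\<Sum>k\<in>I. \<Sum>j\<in>I. of_int (M i k) * of_int (N k j) * v j)"
      using N(2) by (simp add: sum_distrib_left mult_ac)
    also have "\<dots> = (\<Sum>j\<in>I. of_int (\<Sum>k\<in>I. M i k * N k j) * v j)"
      by (subst sum.swap) (simp add: sum_distrib_right)
    finally show "(\<xi> * \<eta>) * v i = (\<Sum>j\<in>I. of_int (\<Sum>k\<in>I. M i k * N k j) * v j)" .
  qed
qed

lemma int_rep_power:
  assumes "finite I" "int_rep I v H \<xi>" "0 \<le> H"
  shows "int_rep I v (H ^ n) (\<xi> ^ n)"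
proof (induction n)
  case 0
  show ?case using int_rep_of_int[OF assms(1), of v 1] by simp
next
  case (Suc n)
  show ?case using int_rep_mult[OF assms(2) Suc] assms(3) by simp
qed

lemma int_rep_sum:
  assumes "finite I" "finite A" "\<And>a. a \<in> A \<Longrightarrow> int_rep I v (H a) (\<xi> a)"
  shows "int_rep I v (\<Sum>a\<in>A. H a) (\<Sum>a\<in>A. \<xi> a)"
  using assms(2,3)
proof (induction A rule: finite_induct)
  case empty
  show ?case using int_rep_of_int[OF assms(1), of v 0] by simp
next
  case (insert a A)
  show ?case using int_rep_add[of I v "H a" "\<xi> a"] insert by simp
qed

section \<open>Tensor products and a common eigenvector for several algebraic numbers\<close>

text \<open>The Kronecker product of \<open>M\<close> with the identity matrix acts on the tensor
  product of \<open>v\<close> and \<open>w\<close>. In this way numbers with different eigenvectors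
  acquire a common one; the row sums do not grow.\<close>

lemma int_rep_Times_left:
  fixes I :: "'a set" and J :: "'b set"
  assumes "finite J" "int_rep I v H \<xi>"
  shows "int_rep (I \<times> J) (\<lambda>(i, j). v i * w j) H \<xi>"
proof -
  from assms(2) obtain M :: "'a \<Rightarrow> 'a \<Rightarrow> int"
    where M: "\<And>i. i \<in> I \<Longrightarrow> (\<Sum>j\<in>I. \<bar>real_of_int (M i j)\<bar>) \<le> H"
    "\<And>i. i \<in> I \<Longrightarrow> \<xi> * v i = (\<Sum>j\<in>I. of_int (M i j) * v j)" by (rule int_repE) blast
  show ?thesis
  proof (rule int_repI[where M = "\<lambda>(i, j) (k, l). if j = l then M i k else 0"])
    fix x assume x: "x \<in> I \<times> J"
    obtain i j where ij: "x = (i, j)" "i \<in> I" "j \<in> J" using x by auto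
    have *: "\<bar>real_of_int ((case x of (i, j) \<Rightarrow> \<lambda>(k, l). if j = l then M i k else 0) y)\<bar> =
       (case y of (k, l) \<Rightarrow> if j = l then \<bar>real_of_int (M i k)\<bar> else 0)" for y
      by (auto simp: ij split: prod.splits)
    have **: "of_int ((case x of (i, j) \<Rightarrow> \<lambda>(k, l). if j = l then M i k else 0) y) * (case y of (i, j) \<Rightarrow> v i * w j) =
       (case y of (k, l) \<Rightarrow> if j = l then of_int (M i k) * v k * w l else 0)" for y
      by (auto simp: ij split: prod.splits)
    show "(\<Sum>y\<in>I \<times> J. \<bar>real_of_int ((case x of (i, j) \<Rightarrow> \<lambda>(k, l). if j = l then M i k else 0) y)\<bar>) \<le> H"
      unfolding * sum.cartesian_product[symmetric] using assms(1) ij M(1) by simp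
    show "\<xi> * (case x of (i, j) \<Rightarrow> v i * w j) = (\<Sum>y\<in>I \<times> J. of_int ((case x of (i, j) \<Rightarrow> \<lambda>(k, l). if j = l then M i k else 0) y)
        * (case y of (i, j) \<Rightarrow> v i * w j))"
      unfolding ** sum.cartesian_product[symmetric] using assms(1) ij M(2)[of i]
      by (simp add: sum_distrib_right[symmetric] mult.assoc[symmetric])
  qed
qed

lemma int_rep_reindex:
  fixes I :: "'a set" and J :: "'b set"
  assumes "bij_betw f I J" "int_rep J v H \<xi>"
  shows "int_rep I (v \<circ> f) H \<xi>"
proof -
  from assms(2) obtain M :: "'b \<Rightarrow> 'b \<Rightarrow> int"
    where M: "\<And>i. i \<in> J \<Longrightarrow> (\<Sum>j\<in>J. \<bar>real_of_int (M i j)\<bar>) \<le> H"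
    "\<And>i. i \<in> J \<Longrightarrow> \<xi> * v i = (\<Sum>j\<in>J. of_int (M i j) * v j)" by (rule int_repE) blast
  have f: "f i \<in> J" if "i \<in> I" for i using assms(1) that by (auto dest: bij_betwE)
  show ?thesis
  proof (rule int_repI[where M = "\<lambda>i j. M (f i) (f j)"])
    fix i assume i: "i \<in> I"
    show "(\<Sum>j\<in>I. \<bar>real_of_int (M (f i) (f j))\<bar>) \<le> H"
      using M(1)[OF f[OF i]] sum.reindex_bij_betw[OF assms(1), of "\<lambda>j. \<bar>real_of_int (M (f i) j)\<bar>"] by simp
    show "\<xi> * (v \<circ> f) i = (\<Sum>j\<in>I. of_int (M (f i) (f j)) * (v \<circ> f) j)"
      using M(2)[OF f[OF i]] sum.reindex_bij_betw[OF assms(1), of "\<lambda>j. of_int (M (f i) j) * v j"] by simp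
  qed
qed

lemma int_rep_Times_right:
  assumes "finite I" "int_rep J w H \<xi>"
  shows "int_rep (I \<times> J) (\<lambda>(i, j). v i * w j) H \<xi>"
proof -
  have b: "bij_betw prod.swap (I \<times> J) (J \<times> I)"
    by (rule bij_betwI[where g = prod.swap]) auto
  have "((\<lambda>(j, i). w j * v i) \<circ> prod.swap) = (\<lambda>(i, j). v i * w j)"
    by (auto simp: fun_eq_iff mult_ac)
  then show ?thesis
    using int_rep_reindex[OF b int_rep_Times_left[OF assms, of v]] by metis
qed

text \<open>With \<open>q\<close> the absolute leading coefficient of an integer polynomial
  vanishing at \<alpha>, \<open>q\<close> times the companion matrix is integral and has the vector
  of powers 1, \<alpha>, ..., \<alpha> ^ (d - 1) as eigenvector.\<close>

lemma algebraic_int_rep: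
  assumes "algebraic \<alpha>"
  obtains d q :: nat and H :: real
  where "0 < d" "0 < q" "0 \<le> H" "int_rep {..<d} (\<lambda>i. \<alpha> ^ i) H (of_nat q * \<alpha>)"
proof -
  obtain p where p: "\<And>i. coeff p i \<in> \<int>" "p \<noteq> 0" "poly p \<alpha> = 0"
    using assms by (elim algebraicE) auto
  define d where "d = degree p"
  have "d > 0"
  proof (rule ccontr)
    assume "\<not> d > 0"
    then obtain c where "p = [:c:]" unfolding d_def by (auto elim: degree_eq_zeroE)
    with p show False by auto
  qed
  have "\<forall>i. \<exists>z. coeff p i = of_int z" using p(1) unfolding Ints_def by blast
  then obtain b where b: "\<And>i. coeff p i = of_int (b i)" by metis
  have bd: "b d \<noteq> 0" using p(2) b[of d] unfolding d_def by (metis leading_coeff_0_iff of_int_0)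
  \<comment> \<open>The sign of the leading coefficient is moved into \<open>e\<close>, so that the
    denominator \<open>q\<close> is a positive natural number.\<close>
  define e where "e i = - sgn (b d) * b i" for i
  define q where "q = nat \<bar>b d\<bar>"
  have qe: "of_nat q = (of_int (sgn (b d) * b d) :: complex)"
    unfolding q_def using bd by (auto simp: abs_sgn sgn_if)
  have "poly p \<alpha> = (\<Sum>i\<le>d. of_int (b i) * \<alpha> ^ i)"
    unfolding poly_altdef d_def b by simp
  also have "\<dots> = (\<Sum>i<d. of_int (b i) * \<alpha> ^ i) + of_int (b d) * \<alpha> ^ d"
    by (simp add: lessThan_Suc_atMost[symmetric])
  finally have bda: "of_int (b d) * \<alpha> ^ d = - (\<Sum>i<d. of_int (b i) * \<alpha> ^ i)"
    using p(3) by (simp add: eq_neg_iff_add_eq_0 add.commute)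
  have qa: "of_nat q * \<alpha> ^ d = (\<Sum>i<d. of_int (e i) * \<alpha> ^ i)"
  proof -
    have "of_nat q * \<alpha> ^ d = of_int (sgn (b d)) * (of_int (b d) * \<alpha> ^ d)" unfolding qe by simp
    also have "\<dots> = (\<Sum>i<d. of_int (e i) * \<alpha> ^ i)"
      unfolding bda e_def by (simp add: sum_distrib_left sum_negf mult_ac)
    finally show ?thesis .
  qed
  \<comment> \<open>All rows but the last shift the power up by one, scaled by \<open>q\<close>; the
    last row expresses \<open>q * \<alpha> ^ d\<close> through lower powers. \<open>H\<close>
    dominates both kinds of row.\<close>
  define M where "M i j = (if Suc i < d then (if j = Suc i then int q else 0) else e j)" for i j
  define H where "H = real q + (\<Sum>j<d. \<bar>real_of_int (e j)\<bar>)"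
  have "int_rep {..<d} (\<lambda>i. \<alpha> ^ i) H (of_nat q * \<alpha>)"
  proof (rule int_repI[where M = M])
    fix i assume "i \<in> {..<d}"
    then have i: "i < d" by simp
    show "(\<Sum>j<d. \<bar>real_of_int (M i j)\<bar>) \<le> H"
    proof (cases "Suc i < d")
      case True
      have "(\<Sum>j<d. \<bar>real_of_int (M i j)\<bar>) = (\<Sum>j<d. if j = Suc i then real q else 0)"
        by (intro sum.cong) (auto simp: M_def True)
      also have "\<dots> = real q" using True by simp
      finally show ?thesis by (simp add: H_def sum_nonneg)
    qed (simp add: M_def H_def)
    show "of_nat q * \<alpha> * \<alpha> ^ i = (\<Sum>j<d. of_int (M i j) * \<alpha> ^ j)"
    proof (cases "Suc i < d")
      case True
      have "(\<Sum>j<d. of_int (M i j) * \<alpha> ^ j) = (\<Sum>j<d. if j = Suc i then of_nat q * \<alpha> ^ j else 0)"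
        by (intro sum.cong) (auto simp: M_def True)
      then show ?thesis using True by (simp add: mult_ac)
    next
      case False
      then have "d = Suc i" using i by simp
      then show ?thesis using qa False by (simp add: M_def mult_ac)
    qed
  qed
  moreover have "q > 0" using bd by (simp add: q_def)
  moreover have "H \<ge> 0" by (simp add: H_def sum_nonneg)
  ultimately show ?thesis using that \<open>d > 0\<close> by blast
qed

lemma algebraic3_int_rep:
  assumes "algebraic \<alpha>" "algebraic \<beta>" "algebraic \<gamma>"
  obtains I :: "((nat \<times> nat) \<times> nat) set" and v i0 and q :: nat and H :: real
  where "finite I" "i0 \<in> I" "v i0 \<noteq> 0" "0 < q" "real q \<le> H"
    "int_rep I v H (of_nat q * \<alpha>)" "int_rep I v H (of_nat q * \<beta>)" "int_rep I v H (of_nat q * \<gamma>)"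
proof -
  obtain d1 q1 :: nat and H1 :: real where 1: "0 < d1" "0 < q1" "0 \<le> H1"
    "int_rep {..<d1} (\<lambda>i. \<alpha> ^ i) H1 (of_nat q1 * \<alpha>)"
    using algebraic_int_rep[OF assms(1)] .
  obtain d2 q2 :: nat and H2 :: real where 2: "0 < d2" "0 < q2" "0 \<le> H2"
    "int_rep {..<d2} (\<lambda>i. \<beta> ^ i) H2 (of_nat q2 * \<beta>)"
    using algebraic_int_rep[OF assms(2)] .
  obtain d3 q3 :: nat and H3 :: real where 3: "0 < d3" "0 < q3" "0 \<le> H3"
    "int_rep {..<d3} (\<lambda>i. \<gamma> ^ i) H3 (of_nat q3 * \<gamma>)"
    using algebraic_int_rep[OF assms(3)] .
  define I where "I = ({..<d1} \<times> {..<d2}) \<times> {..<d3}"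
  define v where "v = (\<lambda>(x, k). (\<lambda>(i, j). \<alpha> ^ i * \<beta> ^ j) x * \<gamma> ^ k)"
  have fin: "finite I" by (simp add: I_def)
  have a: "int_rep I v H1 (of_nat q1 * \<alpha>)"
    unfolding I_def v_def by (intro int_rep_Times_left 1 finite_lessThan)
  have b: "int_rep I v H2 (of_nat q2 * \<beta>)"
    unfolding I_def v_def by (intro int_rep_Times_left int_rep_Times_right 2 finite_lessThan)
  have c: "int_rep I v H3 (of_nat q3 * \<gamma>)"
    unfolding I_def v_def by (intro int_rep_Times_right 3 finite_lessThan finite_cartesian_product)
  define q where "q = q1 * q2 * q3"
  define H where "H = real q + real (q2 * q3) * H1 + real (q1 * q3) * H2 + real (q1 * q2) * H3"
  have scale: "int_rep I v H (of_nat q * \<xi>)"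
    if "int_rep I v G (of_nat r * \<xi>)" "q = s * r" "real s * G \<le> H" "0 \<le> G" for r s G \<xi>
    using int_rep_mult[OF int_rep_of_int[OF fin, of v "int s"] that(1,4)]
    by (intro int_rep_mono[OF _ that(3)]) (simp add: that(2) mult_ac)
  show ?thesis
  proof
    show "finite I" by fact
    show "((0, 0), 0) \<in> I" using 1 2 3 by (simp add: I_def)
    show "v ((0, 0), 0) \<noteq> 0" by (simp add: v_def)
    show "0 < q" using 1 2 3 by (simp add: q_def)
    show "real q \<le> H" using 1 2 3 by (simp add: H_def)
    show "int_rep I v H (of_nat q * \<alpha>)"
      by (rule scale[OF a, of "q2 * q3"]) (use 1 2 3 in \<open>auto simp: q_def H_def\<close>)
    show "int_rep I v H (of_nat q * \<beta>)"
      by (rule scale[OF b, of "q1 * q3"]) (use 1 2 3 in \<open>auto simp: q_def H_def\<close>)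
    show "int_rep I v H (of_nat q * \<gamma>)"
      by (rule scale[OF c, of "q1 * q2"]) (use 1 2 3 in \<open>auto simp: q_def H_def\<close>)
  qed
qed

section \<open>A Liouville inequality for eigenvalues of integer matrices\<close>

lemma prod_list_linear_split_zero:
  fixes as :: "'a :: comm_ring_1 list"
  shows "(\<Prod>a\<leftarrow>as. [:- a, 1:]) =
    monom 1 (length (filter (\<lambda>a. a = 0) as)) * (\<Prod>a\<leftarrow>filter (\<lambda>a. a \<noteq> 0) as. [:- a, 1:])"
proof (induction as)
  case (Cons a as)
  have X: "[:0, 1:] = monom (1::'a) (Suc 0)" by (simp add: monom_Suc)
  show ?case
  proof (cases "a = 0")
    case True
    then show ?thesis by (simp add: Cons X mult_monom mult.assoc[symmetric] del: monom_eq_1_iff)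
  next
    case False
    then have "filter (\<lambda>a. a = 0) (a # as) = filter (\<lambda>a. a = 0) as"
      "filter (\<lambda>a. a \<noteq> 0) (a # as) = a # filter (\<lambda>a. a \<noteq> 0) as" by auto
    then show ?thesis by (simp only: list.map prod_list.Cons Cons mult.left_commute)
  qed
qed simp

text \<open>After the factors belonging to the root 0 are split off as a monomial, the product in
  question is the lowest nonzero coefficient of \<open>p\<close>, hence an integer.\<close>

lemma prod_nonzero_roots_Ints:
  fixes p :: "int poly" and as :: "complex list"
  assumes "map_poly of_int p = (\<Prod>a\<leftarrow>as. [:- a, 1:])"
  shows "(\<Prod>a\<leftarrow>filter (\<lambda>a. a \<noteq> 0) as. - a) \<in> \<int>"
proof -
  let ?k = "length (filter (\<lambda>a. a = 0) as)" and ?q = "\<Prod>a\<leftarrow>filter (\<lambda>a. a \<noteq> 0) as. [:- a, 1:]"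
  have "of_int (coeff p ?k) = coeff (map_poly of_int p :: complex poly) ?k" by (simp add: coeff_map_poly)
  also have "\<dots> = coeff ?q 0"
    unfolding assms by (subst prod_list_linear_split_zero) (simp add: coeff_monom_mult)
  also have "\<dots> = (\<Prod>a\<leftarrow>filter (\<lambda>a. a \<noteq> 0) as. - a)"
    by (simp add: poly_0_coeff_0[symmetric] poly_prod_list o_def)
  finally show ?thesis by (metis Ints_of_int)
qed

text \<open>The eigenvalue equation is read off in a row where the eigenvector entry has maximal
  modulus.\<close>

lemma eigenvalue_norm_le_row_sum:
  fixes A :: "complex mat"
  assumes A: "A \<in> carrier_mat n n" and ev: "eigenvalue A a"
    and H: "\<And>i. i < n \<Longrightarrow> (\<Sum>j<n. cmod (A $$ (i, j))) \<le> H"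
  shows "cmod a \<le> H"
proof -
  obtain w where w: "w \<in> carrier_vec n" "w \<noteq> 0\<^sub>v n" "A *\<^sub>v w = a \<cdot>\<^sub>v w"
    using ev A unfolding eigenvalue_def eigenvector_def by auto
  define f where "f i = cmod (vec_index w i)" for i
  obtain i0 where i0: "i0 < n" "f i0 \<noteq> 0"
    using w(1,2) by (force simp: f_def)
  define m where "m = Max (f ` {..<n})"
  have fin: "finite (f ` {..<n})" "f ` {..<n} \<noteq> {}" using i0 by auto
  have m: "f i \<le> m" if "i < n" for i unfolding m_def using that by (intro Max_ge) auto
  obtain i where i: "i < n" "f i = m" using Max_in[OF fin] unfolding m_def by auto
  have mpos: "m > 0" using m[OF i0(1)] i0 by (smt (verit) f_def norm_ge_zero)
  have "a * vec_index w i = vec_index (A *\<^sub>v w) i" using w i by simp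
  also have "vec_index (A *\<^sub>v w) i = (\<Sum>j<n. A $$ (i, j) * vec_index w j)"
    using A w(1) i by (auto simp: scalar_prod_def atLeast0LessThan simp del: w(3) intro!: sum.cong)
  finally have "cmod a * m = cmod (\<Sum>j<n. A $$ (i, j) * vec_index w j)"
    using i(2) unfolding f_def by (metis norm_mult)
  also have "\<dots> \<le> (\<Sum>j<n. cmod (A $$ (i, j)) * m)"
    using m by (intro sum_norm_le) (auto simp: norm_mult f_def intro!: mult_left_mono)
  also have "\<dots> \<le> H * m"
    using H[OF i(1)] mpos by (simp add: sum_distrib_right[symmetric])
  finally show ?thesis using mpos by simp
qed

lemma prod_list_norm_le_power:
  fixes as :: "complex list"
  assumes "\<And>a. a \<in> set as \<Longrightarrow> cmod a \<le> H" "1 \<le> H"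
  shows "cmod (prod_list as) \<le> H ^ length as"
  using assms(1)
proof (induction as)
  case (Cons a as)
  then show ?case using assms(2) by (auto simp: norm_mult intro!: mult_mono)
qed simp

text \<open>This takes the place of the norm from a number field: \<xi> is one of the nonzero
  eigenvalues, their product is a nonzero integer and so has modulus at least 1, and each of the
  others has modulus at most \<open>H\<close>.\<close>

lemma int_rep_lower_bound:
  assumes rep: "int_rep I v H \<xi>" and fin: "finite I" and i0: "i0 \<in> I" "v i0 \<noteq> 0"
    and "\<xi> \<noteq> 0" and H: "1 \<le> H"
  shows "1 \<le> cmod \<xi> * H ^ card I"
proof -
  define n where "n = card I"
  \<comment> \<open>The index set is enumerated because matrices are indexed by initial segments of
    the naturals.\<close>
  obtain f where f: "bij_betw f {..<n} I"
    using ex_bij_betw_nat_finite[OF fin] by (auto simp: n_def atLeast0LessThan)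
  from int_rep_reindex[OF f rep] obtain M :: "nat \<Rightarrow> nat \<Rightarrow> int" where
    M: "\<And>i. i < n \<Longrightarrow> (\<Sum>j<n. \<bar>real_of_int (M i j)\<bar>) \<le> H"
    "\<And>i. i < n \<Longrightarrow> \<xi> * v (f i) = (\<Sum>j<n. of_int (M i j) * v (f j))"
    by (rule int_repE) auto
  define A where "A = mat n n (\<lambda>(i, j). M i j)"
  define B where "B = map_mat (of_int :: int \<Rightarrow> complex) A"
  have A: "A \<in> carrier_mat n n" and B: "B \<in> carrier_mat n n" by (auto simp: A_def B_def)
  have Bij: "B $$ (i, j) = of_int (M i j)" if "i < n" "j < n" for i j
    using that by (simp add: B_def A_def)
  obtain as where as: "char_poly B = (\<Prod>a\<leftarrow>as. [:- a, 1:])" "length as = n"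
    using char_poly_factorized[OF B] by blast
  have as_ev: "a \<in> set as \<longleftrightarrow> eigenvalue B a" for a
    unfolding eigenvalue_root_char_poly[OF B] as(1) poly_prod_list prod_list_zero_iff
    by auto
  have bound: "cmod a \<le> H" if "a \<in> set as" for a
    by (rule eigenvalue_norm_le_row_sum[OF B]) (use that as_ev M(1) in \<open>auto simp: Bij\<close>)
  obtain k0 where k0: "k0 < n" "f k0 = i0" using f i0 by (auto simp: bij_betw_def)
  have "eigenvector B (vec n (\<lambda>i. v (f i))) \<xi>"
    unfolding eigenvector_def
  proof (intro conjI)
    show "vec n (\<lambda>i. v (f i)) \<in> carrier_vec (dim_row B)" using B by simp
    show "vec n (\<lambda>i. v (f i)) \<noteq> 0\<^sub>v (dim_row B)"
    proof
      assume "vec n (\<lambda>i. v (f i)) = 0\<^sub>v (dim_row B)"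
      from arg_cong[OF this, of "\<lambda>u. vec_index u k0"] show False using k0 i0 B by simp
    qed
    show "B *\<^sub>v vec n (\<lambda>i. v (f i)) = \<xi> \<cdot>\<^sub>v vec n (\<lambda>i. v (f i))"
    proof (rule eq_vecI)
      fix i assume "i < dim_vec (\<xi> \<cdot>\<^sub>v vec n (\<lambda>i. v (f i)))"
      then have i: "i < n" by simp
      have "vec_index (B *\<^sub>v vec n (\<lambda>i. v (f i))) i = (\<Sum>j<n. of_int (M i j) * v (f j))"
        using B i by (auto simp: scalar_prod_def atLeast0LessThan Bij intro!: sum.cong)
      then show "vec_index (B *\<^sub>v vec n (\<lambda>i. v (f i))) i = vec_index (\<xi> \<cdot>\<^sub>v vec n (\<lambda>i. v (f i))) i"
        using M(2)[OF i] i by simp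
    qed (use B in simp)
  qed
  then have \<xi>as: "\<xi> \<in> set as" using as_ev unfolding eigenvalue_def by blast
  define bs where "bs = filter (\<lambda>a. a \<noteq> 0) as"
  have "map_poly of_int (char_poly A) = (\<Prod>a\<leftarrow>as. [:- a, 1:])"
    using of_int_hom.char_poly_hom[OF A, where ?'a = complex] as(1) unfolding B_def by simp
  from prod_nonzero_roots_Ints[OF this] have int: "(\<Prod>a\<leftarrow>bs. - a) \<in> \<int>" unfolding bs_def .
  have ne: "(\<Prod>a\<leftarrow>bs. - a) \<noteq> 0" by (auto simp: prod_list_zero_iff bs_def)
  have nrm: "cmod (\<Prod>a\<leftarrow>cs. - a) = cmod (prod_list cs)" for cs
    by (induction cs) (auto simp: norm_mult)
  obtain z where z: "(\<Prod>a\<leftarrow>bs. - a) = of_int z" using int by (rule Ints_cases)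
  with ne have "z \<noteq> 0" by auto
  then have "1 \<le> cmod (\<Prod>a\<leftarrow>bs. - a)" unfolding z by simp
  then have one: "1 \<le> cmod (prod_list bs)" by (simp add: nrm)
  \<comment> \<open>Just one occurrence of \<xi> is isolated; any further occurrences are bounded by
    \<open>H\<close> like the other eigenvalues.\<close>
  obtain ys zs where split: "bs = ys @ \<xi> # zs"
    using \<xi>as \<open>\<xi> \<noteq> 0\<close> split_list[of \<xi> bs] by (auto simp: bs_def)
  note one
  also have "prod_list bs = \<xi> * prod_list (ys @ zs)" by (simp add: split)
  also have "cmod \<dots> \<le> cmod \<xi> * H ^ length (ys @ zs)"
  proof -
    have "set (ys @ zs) \<subseteq> set as" using split by (auto simp: bs_def dest!: arg_cong[where f = set])
    then show ?thesis unfolding norm_mult using bound H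
      by (intro mult_left_mono prod_list_norm_le_power) auto
  qed
  also have "\<dots> \<le> cmod \<xi> * H ^ n"
  proof (intro mult_left_mono power_increasing H)
    have "length (ys @ zs) \<le> length bs" by (simp add: split)
    also have "\<dots> \<le> n" unfolding bs_def as(2)[symmetric] by (rule length_filter_le)
    finally show "length (ys @ zs) \<le> n" .
  qed auto
  finally show ?thesis by (simp add: n_def)
qed

section \<open>Siegel's lemma, power sums, and zeros of entire functions\<close>

text \<open>Having at least twice as many unknowns as equations makes the usual exponent
  \<open>card E / (card U - card E)\<close> at most 1, whence a solution bound linear in
  \<open>A\<close>.\<close>

lemma siegel_int:
  fixes a :: "'e \<Rightarrow> 'u \<Rightarrow> int" and A :: nat
  assumes fin: "finite E" "finite U" and card: "2 * card E \<le> card U" "U \<noteq> {}"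
    and A: "0 < A" "\<And>e u. e \<in> E \<Longrightarrow> u \<in> U \<Longrightarrow> \<bar>a e u\<bar> \<le> int A"
  obtains x :: "'u \<Rightarrow> int" where "\<exists>u\<in>U. x u \<noteq> 0" "\<And>u. u \<in> U \<Longrightarrow> \<bar>x u\<bar> \<le> int (card U * A)"
    "\<And>e. e \<in> E \<Longrightarrow> (\<Sum>u\<in>U. a e u * x u) = 0"
proof -
  define X where "X = card U * A"
  have cU: "card U > 0" using fin card by (simp add: card_gt_0_iff)
  have X: "X > 0" using cU A by (simp add: X_def)
  define S where "S = (\<Pi>\<^sub>E u\<in>U. {0..int X})"
  \<comment> \<open>A lower bound for the form \<open>e\<close> on the box; its values spread over
    at most \<open>card U * A * X = X * X\<close>.\<close>
  define lo where "lo e = (\<Sum>u\<in>U. min (a e u) 0 * int X)" for e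
  define T where "T = (\<Pi>\<^sub>E e\<in>E. {lo e..lo e + int (X * X)})"
  \<comment> \<open>pigeonhole on the box of vectors with entries in \<open>{0..X}\<close>: its images under \<open>a\<close> lie in the smaller box \<open>T\<close>\<close>
  define F where "F x = (\<lambda>e\<in>E. \<Sum>u\<in>U. a e u * x u)" for x
  have "F x \<in> T" if x: "x \<in> S" for x
    unfolding F_def T_def
  proof (intro restrict_PiE_iff[THEN iffD2] ballI)
    fix e assume e: "e \<in> E"
    have xb: "0 \<le> x u" "x u \<le> int X" if "u \<in> U" for u
      using x that unfolding S_def by (auto simp: PiE_iff)
    have "lo e \<le> (\<Sum>u\<in>U. a e u * x u)"
      unfolding lo_def
    proof (rule sum_mono)
      fix u assume u: "u \<in> U"
      have "min (a e u) 0 * int X \<le> min (a e u) 0 * x u"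
        using xb[OF u] by (intro mult_left_mono_neg) auto
      also have "\<dots> \<le> a e u * x u" using xb[OF u] by (intro mult_right_mono) auto
      finally show "min (a e u) 0 * int X \<le> a e u * x u" .
    qed
    moreover have "(\<Sum>u\<in>U. a e u * x u) - lo e \<le> (\<Sum>u\<in>U. int A * int X)"
      unfolding lo_def sum_subtractf[symmetric]
    proof (rule sum_mono)
      fix u assume u: "u \<in> U"
      have "a e u * x u \<le> max (a e u) 0 * x u" using xb[OF u] by (intro mult_right_mono) auto
      also have "\<dots> \<le> max (a e u) 0 * int X" using xb[OF u] by (intro mult_left_mono) auto
      finally have "a e u * x u - min (a e u) 0 * int X \<le> (max (a e u) 0 - min (a e u) 0) * int X"
        by (simp add: left_diff_distrib)
      also have "max (a e u) 0 - min (a e u) 0 = \<bar>a e u\<bar>" by auto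
      also have "\<bar>a e u\<bar> * int X \<le> int A * int X" using A(2)[OF e u] by (intro mult_right_mono) auto
      finally show "a e u * x u - min (a e u) 0 * int X \<le> int A * int X" .
    qed
    ultimately show "(\<Sum>u\<in>U. a e u * x u) \<in> {lo e..lo e + int (X * X)}"
      by (simp add: X_def)
  qed
  then have sub: "F ` S \<subseteq> T" by blast
  have finT: "finite T" unfolding T_def using fin by (intro finite_PiE) auto
  have "card T = (X * X + 1) ^ card E"
    unfolding T_def using fin by (simp add: card_PiE nat_add_distrib nat_mult_distrib)
  also have "\<dots> < (X + 1) ^ card U"
  \<comment> \<open>The strictness comes from \<open>X * X + 1 < (X + 1)\<^sup>2\<close>, which is
    lost at exponent 0; there it comes from \<open>card U > 0\<close>.\<close>
  proof (cases "card E = 0")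
    case True
    then show ?thesis using cU X one_less_power[of "X + 1" "card U"] by simp
  next
    case False
    have "(X * X + 1) ^ card E < ((X + 1)\<^sup>2) ^ card E"
      using False X by (intro power_strict_mono) (auto simp: power2_eq_square)
    also have "\<dots> = (X + 1) ^ (2 * card E)" by (simp add: power_mult)
    also have "\<dots> \<le> (X + 1) ^ card U" using card by (intro power_increasing) auto
    finally show ?thesis .
  qed
  also have "\<dots> = card S"
    unfolding S_def using fin by (simp add: card_PiE nat_add_distrib)
  finally have "card (F ` S) < card S" using card_mono[OF finT sub] by linarith
  then have "\<not> inj_on F S" using pigeonhole by blast
  then obtain x y where xy: "x \<in> S" "y \<in> S" "F x = F y" "x \<noteq> y" by (auto simp: inj_on_def)
  show ?thesis
  proof (rule that[of "\<lambda>u. x u - y u"])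
    \<comment> \<open>Both vectors are extensional, so they must differ at a point of
      \<open>U\<close>.\<close>
    show "\<exists>u\<in>U. x u - y u \<noteq> 0"
      using xy PiE_ext[of x U "\<lambda>_. {0..int X}" y] unfolding S_def by auto
    fix u assume "u \<in> U"
    then have "0 \<le> x u" "x u \<le> int X" "0 \<le> y u" "y u \<le> int X"
      using xy unfolding S_def by (auto simp: PiE_iff)
    then show "\<bar>x u - y u\<bar> \<le> int (card U * A)" unfolding X_def by linarith
  next
    fix e assume "e \<in> E"
    with fun_cong[OF xy(3), of e] show "(\<Sum>u\<in>U. a e u * (x u - y u)) = 0"
      by (simp add: F_def right_diff_distrib sum_subtractf)
  qed
qed

text \<open>A Vandermonde argument without determinants: by linearity the relation holds with any
  polynomial in place of a power, in particular with one vanishing at every node except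
  \<open>w a\<close>.\<close>

lemma power_sums_eq_0_imp_coeff_eq_0:
  fixes c w :: "'a \<Rightarrow> 'b :: idom"
  assumes fin: "finite W" and inj: "inj_on w W"
    and zero: "\<And>s::nat. (\<Sum>a\<in>W. c a * w a ^ s) = 0" and a: "a \<in> W"
  shows "c a = 0"
proof -
  have poly0: "(\<Sum>a\<in>W. c a * poly p (w a)) = 0" for p
  proof -
    have "(\<Sum>a\<in>W. c a * poly p (w a)) = (\<Sum>i\<le>degree p. coeff p i * (\<Sum>a\<in>W. c a * w a ^ i))"
      unfolding poly_altdef sum_distrib_left by (subst sum.swap) (simp add: mult_ac)
    then show ?thesis using zero by simp
  qed
  define p where "p = (\<Prod>b\<in>W - {a}. [:- w b, 1:])"
  have p: "poly p (w b) = 0" if "b \<in> W" "b \<noteq> a" for b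
    using that fin by (auto simp: p_def poly_prod intro!: prod_zero)
  have "poly p (w a) \<noteq> 0"
    using fin inj a by (auto simp: p_def poly_prod inj_on_def)
  moreover have "(\<Sum>b\<in>W. c b * poly p (w b)) = c a * poly p (w a)"
    using p a fin by (subst sum.remove[of _ a]) auto
  ultimately show ?thesis using poly0[of p] by auto
qed

section \<open>Dividing an entire function by its zeros\<close>

lemma higher_deriv_linear_mult:
  assumes "g holomorphic_on UNIV"
  shows "(deriv ^^ Suc n) (\<lambda>z. (z - l) * g z) l = of_nat (Suc n) * (deriv ^^ n) g l"
proof -
  have lin: "(deriv ^^ i) (\<lambda>w. w - l) = (\<lambda>w. if i = 0 then w - l else if i = 1 then 1 else 0)" for i :: nat
  proof (induction i)
    case (Suc i)
    show ?case unfolding funpow.simps o_apply Suc.IH by (cases "i = 0"; cases "i = 1") auto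
  qed auto
  have "(deriv ^^ Suc n) (\<lambda>z. (z - l) * g z) l =
      (\<Sum>i = 0..Suc n. of_nat (Suc n choose i) * (deriv ^^ i) (\<lambda>w. w - l) l * (deriv ^^ (Suc n - i)) g l)"
    by (rule higher_deriv_mult[of _ UNIV]) (auto intro!: holomorphic_intros assms)
  also have "\<dots> = (\<Sum>i = 0..Suc n. if i = 1 then of_nat (Suc n) * (deriv ^^ n) g l else 0)"
    by (intro sum.cong) (auto simp: lin)
  also have "\<dots> = of_nat (Suc n) * (deriv ^^ n) g l"
    by (subst sum.delta) auto
  finally show ?thesis .
qed

text \<open>Induction on \<open>r\<close>, dividing by one factor \<open>z - l\<close> at a time.
  The last conclusion recovers the derivative from the cofactor, so that bounds on the cofactor
  become bounds on the derivative.\<close>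

lemma entire_factor_power:
  assumes "f holomorphic_on UNIV" "\<And>s. s < r \<Longrightarrow> (deriv ^^ s) f l = 0"
  obtains h where "h holomorphic_on UNIV" "\<And>z. f z = (z - l) ^ r * h z"
    "(deriv ^^ r) f l = fact r * h l"
proof -
  have "\<exists>h. h holomorphic_on UNIV \<and> (\<forall>z. f z = (z - l) ^ r * h z) \<and> (deriv ^^ r) f l = fact r * h l"
    using assms
  proof (induction r arbitrary: f)
    case 0
    then show ?case by auto
  next
    case (Suc r)
    \<comment> \<open>The difference quotient has a removable singularity at \<open>l\<close>,
      filled in by the derivative.\<close>
    define g where "g z = (if z = l then deriv f l else (f z - f l) / (z - l))" for z
    have hg: "g holomorphic_on UNIV"
      unfolding g_def using pole_lemma[of f UNIV l] Suc.prems(1) by simp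
    have "f l = 0" using Suc.prems(2)[of 0] by simp
    then have fg: "f = (\<lambda>z. (z - l) * g z)" by (auto simp: g_def)
    have d: "(deriv ^^ Suc n) f l = of_nat (Suc n) * (deriv ^^ n) g l" for n
      unfolding fg by (rule higher_deriv_linear_mult[OF hg])
    have "(deriv ^^ s) g l = 0" if "s < r" for s
      using d[of s] Suc.prems(2)[of "Suc s"] that by (simp del: funpow.simps of_nat_Suc)
    from Suc.IH[OF hg this] obtain h where h: "h holomorphic_on UNIV" "\<forall>z. g z = (z - l) ^ r * h z"
      "(deriv ^^ r) g l = fact r * h l" by blast
    have "(deriv ^^ Suc r) f l = fact (Suc r) * h l"
      unfolding d h(3) by simp
    moreover have "\<forall>z. f z = (z - l) ^ Suc r * h z"
      using h(2) by (simp add: fg)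
    ultimately show ?case using h(1) by blast
  qed
  then show ?thesis using that by blast
qed

lemma entire_factor_powers:
  assumes hol: "f holomorphic_on UNIV" and Z: "finite Z"
    and zero: "\<And>s l. l \<in> Z \<Longrightarrow> s < r \<Longrightarrow> (deriv ^^ s) f l = 0"
  obtains g where "g holomorphic_on UNIV" "\<And>z. f z = (\<Prod>l\<in>Z. (z - l) ^ r) * g z"
    "\<And>l. l \<in> Z \<Longrightarrow> (deriv ^^ r) f l = fact r * (\<Prod>k\<in>Z - {l}. (l - k) ^ r) * g l"
proof -
  have "\<forall>l\<in>Z. \<exists>h. h holomorphic_on UNIV \<and> (\<forall>z. f z = (z - l) ^ r * h z) \<and> (deriv ^^ r) f l = fact r * h l"
    using entire_factor_power[OF hol zero] by metis
  then obtain h where h: "\<And>l. l \<in> Z \<Longrightarrow> h l holomorphic_on UNIV"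
    "\<And>l z. l \<in> Z \<Longrightarrow> f z = (z - l) ^ r * h l z"
    "\<And>l. l \<in> Z \<Longrightarrow> (deriv ^^ r) f l = fact r * h l l"
    unfolding bchoice_iff by blast
  define P where "P l z = (\<Prod>k\<in>Z - {l}. (z - k) ^ r)" for l z
  \<comment> \<open>At a zero \<open>z\<close> the value is taken from the local factorization
    there, divided by the factors of the other zeros; elsewhere it is the plain quotient.\<close>
  define g where "g z = (if z \<in> Z then h z z / P z z else f z / (\<Prod>k\<in>Z. (z - k) ^ r))" for z
  have Pnz: "P l z \<noteq> 0" if "z \<notin> Z - {l}" for l z
    using that Z by (auto simp: P_def)
  have split: "(\<Prod>k\<in>Z. (z - k) ^ r) = (z - l) ^ r * P l z" if "l \<in> Z" for l z
    unfolding P_def using Z that by (rule prod.remove)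
  show ?thesis
  proof (rule that[of g])
    have "g field_differentiable at z" for z
    proof (cases "z \<in> Z")
      case True
      \<comment> \<open>Off the other zeros, both cases of \<open>g\<close> agree with one quotient
        that is holomorphic near \<open>z\<close>.\<close>
      have g_eq: "g y = h z y / P z y" if "y \<in> - (Z - {z})" for y
      proof (cases "y = z")
        case False
        then have "y \<notin> Z" using that by simp
        then show ?thesis using False split[OF True, of y] h(2)[OF True, of y] by (simp add: g_def)
      qed (use True in \<open>simp add: g_def\<close>)
      have "(\<lambda>y. h z y / P z y) holomorphic_on - (Z - {z})"
        unfolding P_def
        by (intro holomorphic_intros holomorphic_on_subset[OF h(1)[OF True]]) (use Pnz[of _ z] in \<open>auto simp: P_def\<close>)
      then have "g holomorphic_on - (Z - {z})"
        by (rule holomorphic_transform) (simp add: g_eq)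
      then show ?thesis
        by (rule holomorphic_on_imp_differentiable_at) (use Z in \<open>simp_all add: open_Compl finite_imp_closed del: Compl_Diff_eq\<close>)
    next
      case False
      have "(\<lambda>y. f y / (\<Prod>k\<in>Z. (y - k) ^ r)) holomorphic_on - Z"
        by (intro holomorphic_intros holomorphic_on_subset[OF hol]) (use Z in auto)
      then have "g holomorphic_on - Z"
        by (rule holomorphic_transform) (simp add: g_def)
      then show ?thesis
        by (rule holomorphic_on_imp_differentiable_at) (use Z False in \<open>auto intro!: open_Compl finite_imp_closed\<close>)
    qed
    then show "g holomorphic_on UNIV" by (simp add: holomorphic_on_def)
    show "f z = (\<Prod>l\<in>Z. (z - l) ^ r) * g z" for z
    proof (cases "z \<in> Z")
      case True
      then show ?thesis
        using h(2)[OF True, of z] split[OF True, of z] Pnz[of z z] by (simp add: g_def)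
    next
      case False
      then show ?thesis using Z by (simp add: g_def)
    qed
    show "(deriv ^^ r) f l = fact r * (\<Prod>k\<in>Z - {l}. (l - k) ^ r) * g l" if "l \<in> Z" for l
      using h(3)[OF that] Pnz[of l l] that by (simp add: g_def P_def[symmetric])
  qed
qed

text \<open>The maximum modulus principle is applied to the cofactor \<open>g\<close> on the disc of
  radius \<open>R\<close>. Each zero, counted with order, gains \<open>2 / R\<close> from the circle
  and costs at most \<open>2 * \<rho>\<close> when \<open>g l\<close> is converted back to the
  derivative.\<close>

lemma schwarz_higher_deriv_bound:
  assumes hol: "f holomorphic_on UNIV" and Z: "finite Z" "l \<in> Z"
    and zero: "\<And>s k. k \<in> Z \<Longrightarrow> s < r \<Longrightarrow> (deriv ^^ s) f k = 0"
    and \<rho>: "1 \<le> \<rho>" "\<And>k. k \<in> Z \<Longrightarrow> cmod k \<le> \<rho>"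
    and R: "2 * \<rho> \<le> R" and B: "\<And>z. cmod z = R \<Longrightarrow> cmod (f z) \<le> B"
  shows "cmod ((deriv ^^ r) f l) \<le> fact r * B * ((4 * \<rho> / R) ^ card Z) ^ r"
proof -
  obtain g where g: "g holomorphic_on UNIV" "\<And>z. f z = (\<Prod>l\<in>Z. (z - l) ^ r) * g z"
    "\<And>l. l \<in> Z \<Longrightarrow> (deriv ^^ r) f l = fact r * (\<Prod>k\<in>Z - {l}. (l - k) ^ r) * g l"
    using entire_factor_powers[OF hol Z(1) zero] by metis
  have R0: "R > 0" using \<rho> R by simp
  have "0 \<le> cmod (f (of_real R))" by simp
  also have "\<dots> \<le> B" using R0 by (intro B) simp
  finally have B0: "0 \<le> B" .
  have "cmod (g l) \<le> B * (2 / R) ^ (r * card Z)"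
  proof (rule maximum_modulus_frontier[of g "cball 0 R"])
    show "g holomorphic_on interior (cball 0 R)" using g(1) by (rule holomorphic_on_subset) simp
    show "continuous_on (closure (cball 0 R)) g"
      by (intro holomorphic_on_imp_continuous_on holomorphic_on_subset[OF g(1)]) simp
    show "bounded (cball 0 R :: complex set)" by simp
    show "l \<in> cball 0 R" using \<rho>(2)[OF Z(2)] \<rho>(1) R by simp
    fix z :: complex assume "z \<in> frontier (cball 0 R)"
    then have z: "cmod z = R" by simp
    have far: "R / 2 \<le> cmod (z - k)" if "k \<in> Z" for k
      using norm_triangle_ineq2[of z k] \<rho>(2)[OF that] R z by simp
    have "(R / 2) ^ (r * card Z) = (\<Prod>k\<in>Z. (R / 2) ^ r)" by (simp add: power_mult)
    also have "\<dots> \<le> (\<Prod>k\<in>Z. cmod (z - k) ^ r)"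
      using far R0 by (intro prod_mono conjI power_mono) auto
    also have "\<dots> = cmod (\<Prod>k\<in>Z. (z - k) ^ r)" by (simp add: prod_norm[symmetric] norm_power)
    finally have "(R / 2) ^ (r * card Z) * cmod (g z) \<le> cmod (\<Prod>k\<in>Z. (z - k) ^ r) * cmod (g z)"
      by (rule mult_right_mono) simp
    also have "\<dots> \<le> B" using B[OF z] by (simp add: g(2)[of z] norm_mult)
    finally show "cmod (g z) \<le> B * (2 / R) ^ (r * card Z)"
      using R0 by (simp add: field_simps power_divide)
  qed
  moreover have "cmod (\<Prod>k\<in>Z - {l}. (l - k) ^ r) \<le> (2 * \<rho>) ^ (r * card Z)"
  proof -
    have "cmod (\<Prod>k\<in>Z - {l}. (l - k) ^ r) = (\<Prod>k\<in>Z - {l}. cmod (l - k) ^ r)"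
      by (simp add: prod_norm[symmetric] norm_power)
    also have "\<dots> \<le> (\<Prod>k\<in>Z - {l}. (2 * \<rho>) ^ r)"
    proof (intro prod_mono conjI power_mono)
      fix k assume "k \<in> Z - {l}"
      then show "cmod (l - k) \<le> 2 * \<rho>"
        using norm_triangle_ineq4[of l k] \<rho>(2)[of k] \<rho>(2)[OF Z(2)] by simp
    qed auto
    also have "\<dots> = (2 * \<rho>) ^ (r * card (Z - {l}))" by (simp add: power_mult)
    \<comment> \<open>The missing factor for \<open>l\<close> itself is padded, as
      \<open>2 * \<rho>\<close> is at least 1, to match the exponent in the bound for
      \<open>g l\<close>.\<close>
    also have "\<dots> \<le> (2 * \<rho>) ^ (r * card Z)"
      using \<rho>(1) Z(1) by (intro power_increasing mult_le_mono card_mono) auto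
    finally show ?thesis .
  qed
  ultimately have "cmod ((deriv ^^ r) f l) \<le> fact r * (2 * \<rho>) ^ (r * card Z) * (B * (2 / R) ^ (r * card Z))"
    unfolding g(3)[OF Z(2)] norm_mult using \<rho>(1) B0 R0
    by (intro mult_mono mult_left_mono) auto
  also have "\<dots> = fact r * B * ((2 * \<rho>) * (2 / R)) ^ (r * card Z)"
    by (simp only: power_mult_distrib mult_ac)
  also have "\<dots> = fact r * B * ((4 * \<rho> / R) ^ card Z) ^ r"
    by (simp add: power_mult[symmetric] mult.commute)
  finally show ?thesis .
qed

section \<open>The Gelfond--Schneider theorem\<close>

lemma higher_deriv_exp_sum:
  fixes c w :: "'a \<Rightarrow> complex"
  shows "(deriv ^^ s) (\<lambda>z. \<Sum>u\<in>U. c u * exp (w u * z)) = (\<lambda>z. \<Sum>u\<in>U. c u * w u ^ s * exp (w u * z))"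
proof (induction s)
  case (Suc s)
  have "((\<lambda>z. \<Sum>u\<in>U. c u * w u ^ s * exp (w u * z)) has_field_derivative
      (\<Sum>u\<in>U. c u * w u ^ Suc s * exp (w u * z))) (at z)" for z
    by (rule DERIV_sum) (auto intro!: derivative_eq_intros)
  then show ?case unfolding funpow.simps o_apply Suc.IH by (intro ext DERIV_imp_deriv)
qed simp

text \<open>The factor \<open>q ^ s\<close> clears the denominators of the linear form and
  \<open>q ^ (2 * N * m)\<close> those of the exponentials. The exponent is independent of
  \<open>a\<close>, \<open>b\<close> and \<open>l\<close>, so that terms can be added.\<close>

lemma int_rep_gelfond_term:
  fixes q H N m a b l s :: nat
  assumes fin: "finite I" and q: "q \<le> H"
    and reps: "int_rep I v (real H) (of_nat q * \<alpha>)" "int_rep I v (real H) (of_nat q * \<beta>)"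
      "int_rep I v (real H) (of_nat q * \<gamma>)"
    and ab: "a < N" "b < N" "l \<le> m"
  shows "int_rep I v (real ((2 * N * H) ^ s * H ^ (2 * N * m)))
    (of_nat q ^ (s + 2 * N * m) * ((of_nat a + of_nat b * \<beta>) ^ s * (\<alpha> ^ a * \<gamma> ^ b) ^ l))"
proof -
  have nat_rep: "int_rep I v (real k) (of_nat k)" for k
    using int_rep_of_int[OF fin, of v "int k"] by simp
  have pow: "int_rep I v (real H ^ k) (\<xi> ^ k)" if "int_rep I v (real H) \<xi>" for k \<xi>
    by (rule int_rep_power[OF fin that]) simp
  have "int_rep I v (real (a * q) + real b * real H) (of_nat (a * q) + of_nat b * (of_nat q * \<beta>))"
    by (intro int_rep_add int_rep_mult nat_rep reps) auto
  then have lin: "int_rep I v (real (2 * N * H)) (of_nat (a * q) + of_nat b * (of_nat q * \<beta>))"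
  proof (rule int_rep_mono)
    have "a * q + b * H \<le> N * H + N * H"
      using ab q by (intro add_mono mult_mono) auto
    then show "real (a * q) + real b * real H \<le> real (2 * N * H)"
      by (metis mult.assoc mult_2 of_nat_add of_nat_le_iff of_nat_mult)
  qed
  have "a * l + b * l \<le> N * m + N * m" using ab by (intro add_mono mult_mono) auto
  \<comment> \<open>\<open>e\<close> counts the surplus factors \<open>q\<close>, each of which is
    paid for by a factor \<open>H\<close>.\<close>
  then obtain e where e: "2 * N * m = a * l + b * l + e"
    by (metis le_Suc_ex mult.assoc mult_2)
  have "int_rep I v (real (2 * N * H) ^ s * (real H ^ (a * l) * (real H ^ (b * l) * real H ^ e)))
    ((of_nat (a * q) + of_nat b * (of_nat q * \<beta>)) ^ s *
      ((of_nat q * \<alpha>) ^ (a * l) * ((of_nat q * \<gamma>) ^ (b * l) * of_nat q ^ e)))"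
    by (intro int_rep_mult int_rep_power[OF fin] lin pow reps int_rep_mono[OF nat_rep]) (use q in auto)
  also have "real (2 * N * H) ^ s * (real H ^ (a * l) * (real H ^ (b * l) * real H ^ e)) =
      real ((2 * N * H) ^ s * H ^ (2 * N * m))"
    unfolding e by (simp add: power_add mult_ac)
  also have "(of_nat (a * q) + of_nat b * (of_nat q * \<beta>)) = of_nat q * (of_nat a + of_nat b * \<beta>)"
    by (simp add: algebra_simps)
  also have "(of_nat q * (of_nat a + of_nat b * \<beta>)) ^ s *
      ((of_nat q * \<alpha>) ^ (a * l) * ((of_nat q * \<gamma>) ^ (b * l) * of_nat q ^ e)) =
      of_nat q ^ (s + 2 * N * m) * ((of_nat a + of_nat b * \<beta>) ^ s * (\<alpha> ^ a * \<gamma> ^ b) ^ l)"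
    unfolding e by (simp add: power_add power_mult_distrib power_mult mult_ac)
  finally show ?thesis .
qed

text \<open>Here irrationality of \<beta> enters: distinct frequencies prevent the exponential sum
  from vanishing identically.\<close>

lemma inj_on_nat_linear_form:
  fixes \<beta> :: complex
  assumes "\<beta> \<notin> \<rat>"
  shows "inj_on (\<lambda>u. of_nat (fst u) + of_nat (snd u) * \<beta>) (U :: (nat \<times> nat) set)"
proof (rule inj_onI)
  fix x y :: "nat \<times> nat"
  assume eq: "of_nat (fst x) + of_nat (snd x) * \<beta> = of_nat (fst y) + of_nat (snd y) * \<beta>"
  have "snd x = snd y"
  proof (rule ccontr)
    assume ne: "snd x \<noteq> snd y"
    have "(of_nat (snd x) - of_nat (snd y)) * \<beta> = of_nat (fst y) - of_nat (fst x)"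
      using eq by (simp add: algebra_simps)
    then have "\<beta> = (of_nat (fst y) - of_nat (fst x)) / (of_nat (snd x) - of_nat (snd y))"
      using ne by (simp add: field_simps)
    moreover have "\<dots> \<in> \<rat>" by (intro Rats_divide Rats_diff Rats_of_nat)
    ultimately show False using assms by simp
  qed
  with eq show "x = y" by (simp add: prod_eq_iff)
qed

text \<open>The equation for \<open>N * N\<close> provides twice as many coefficients as there are
  linear conditions. The final inequality multiplies the arithmetic lower bound by
  \<open>cmod t ^ r\<close> and inserts the analytic upper bound. The radius \<open>R\<close> stays
  free, because it is to be chosen in terms of \<open>r\<close>.\<close>

lemma gelfond_auxiliary:
  fixes \<alpha> \<beta> \<gamma> t :: complex and q H N n m :: nat and I :: "'a set"
  assumes fin: "finite I" and i0: "i0 \<in> I" "v i0 \<noteq> 0" and q: "0 < q" "q \<le> H"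
    and reps: "int_rep I v (real H) (of_nat q * \<alpha>)" "int_rep I v (real H) (of_nat q * \<beta>)"
      "int_rep I v (real H) (of_nat q * \<gamma>)"
    and exps: "\<alpha> = exp t" "\<gamma> = exp (\<beta> * t)" and irr: "\<beta> \<notin> \<rat>"
    and N: "0 < N" "N * N = 2 * (n * m * card I)" and m: "0 < m"
  defines "X \<equiv> N ^ 2 * ((2 * N * H) ^ n * H ^ (2 * N * m))"
  obtains r where "n \<le> r"
    "\<And>R. 2 * real m \<le> R \<Longrightarrow> cmod t ^ r \<le> real q ^ (r + 2 * N * m) *
       (fact r * (real (N ^ 2 * X) * exp (N * ((1 + cmod \<beta>) * cmod t) * R)) * ((4 * real m / R) ^ m) ^ r) *
       real (N ^ 2 * X * ((2 * N * H) ^ r * H ^ (2 * N * m))) ^ card I"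
proof -
  define U where "U = {..<N} \<times> {..<N}"
  define w where "w u = of_nat (fst u) + of_nat (snd u) * \<beta>" for u :: "nat \<times> nat"
  define e where "e u = \<alpha> ^ fst u * \<gamma> ^ snd u" for u :: "nat \<times> nat"
  define G where "G s = (2 * N * H) ^ s * H ^ (2 * N * m)" for s
  have finU: "finite U" and cardU: "card U = N ^ 2" by (simp_all add: U_def power2_eq_square)
  have H: "0 < H" using q by simp
  have ene: "e u \<noteq> 0" for u by (simp add: e_def exps)
  have term_rep: "int_rep I v (real (G s)) (of_nat q ^ (s + 2 * N * m) * (w u ^ s * e u ^ l))"
    if "u \<in> U" "l \<le> m" for u l s
    unfolding w_def e_def G_def
    by (rule int_rep_gelfond_term[OF fin q(2) reps]) (use that in \<open>auto simp: U_def\<close>)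
  define P where "P s l u M \<longleftrightarrow> (\<forall>i\<in>I. (\<Sum>j\<in>I. \<bar>real_of_int (M i j)\<bar>) \<le> real (G s) \<and>
      of_nat q ^ (s + 2 * N * m) * (w u ^ s * e u ^ l) * v i = (\<Sum>j\<in>I. of_int (M i j) * v j))"
    for s l u and M :: "'a \<Rightarrow> 'a \<Rightarrow> int"
  \<comment> \<open>Concrete matrices are fixed, since their entries serve as coefficients in the
    linear system.\<close>
  define M where "M s l u = (SOME M. P s l u M)" for s l u
  have "P s l u (M s l u)" if "u \<in> U" "l \<le> m" for s l u
    unfolding M_def using term_rep[OF that] unfolding int_rep_def P_def[symmetric] by (rule someI_ex)
  then have M: "(\<Sum>j\<in>I. \<bar>real_of_int (M s l u i j)\<bar>) \<le> real (G s)"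
      "of_nat q ^ (s + 2 * N * m) * (w u ^ s * e u ^ l) * v i = (\<Sum>j\<in>I. of_int (M s l u i j) * v j)"
    if "u \<in> U" "l \<le> m" "i \<in> I" for s l u i
    using that unfolding P_def by blast+
  \<comment> \<open>For each order below \<open>n\<close> and each point there is one integer
    equation per column, asking that row \<open>i0\<close> of the combined matrix be zero. As
    \<open>v i0\<close> is nonzero, this forces the represented number to vanish.\<close>
  define E where "E = ({..<n} \<times> {1..m}) \<times> I"
  have finE: "finite E" and cardE: "card E = n * m * card I" using fin by (simp_all add: E_def)
  obtain c :: "nat \<times> nat \<Rightarrow> int" where c: "\<exists>u\<in>U. c u \<noteq> 0" "\<And>u. u \<in> U \<Longrightarrow> \<bar>c u\<bar> \<le> int (card U * G n)"
    "\<And>x. x \<in> E \<Longrightarrow> (\<Sum>u\<in>U. (case x of ((s, l), i) \<Rightarrow> M s l u i0 i) * c u) = 0"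
  proof (rule siegel_int[OF finE finU, of "G n" "\<lambda>x u. case x of ((s, l), i) \<Rightarrow> M s l u i0 i"])
    show "2 * card E \<le> card U" using N(2) by (simp add: cardE cardU power2_eq_square)
    show "U \<noteq> {}" using N(1) by (auto simp: U_def)
    show "0 < G n" using N(1) H by (simp add: G_def)
    fix x u assume x: "x \<in> E" and u: "u \<in> U"
    obtain s l i where sli: "x = ((s, l), i)" "s < n" "l \<le> m" "i \<in> I" using x by (auto simp: E_def)
    have "\<bar>real_of_int (M s l u i0 i)\<bar> \<le> (\<Sum>j\<in>I. \<bar>real_of_int (M s l u i0 j)\<bar>)"
      using fin sli by (intro member_le_sum) auto
    also have "\<dots> \<le> real (G s)" using M(1)[OF u] sli i0 by blast
    also have "G s \<le> G n"
      unfolding G_def using N(1) H sli(2) by (intro mult_right_mono power_increasing) auto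
    finally show "\<bar>case x of ((s, l), i) \<Rightarrow> M s l u i0 i\<bar> \<le> int (G n)"
      using sli(1) by simp
  qed auto
  have X: "X = card U * G n" by (simp add: X_def cardU G_def)
  \<comment> \<open>The algebraic part of the derivative of order \<open>s\<close> at
    \<open>l\<close>: the possibly transcendental factor \<open>t ^ s\<close> is left out.\<close>
  define S where "S s l = (\<Sum>u\<in>U. of_int (c u) * (w u ^ s * e u ^ l))" for s l :: nat
  have S0: "S s l = 0" if "s < n" "l \<in> {1..m}" for s l
  proof -
    have "of_nat q ^ (s + 2 * N * m) * S s l * v i0 =
        (\<Sum>u\<in>U. of_int (c u) * (of_nat q ^ (s + 2 * N * m) * (w u ^ s * e u ^ l) * v i0))"
      by (simp add: S_def sum_distrib_left sum_distrib_right mult_ac)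
    also have "\<dots> = (\<Sum>u\<in>U. of_int (c u) * (\<Sum>j\<in>I. of_int (M s l u i0 j) * v j))"
      using M(2) that i0 by (intro sum.cong refl) auto
    also have "\<dots> = (\<Sum>u\<in>U. \<Sum>j\<in>I. of_int (M s l u i0 j * c u) * v j)"
      by (simp add: sum_distrib_left mult_ac)
    also have "\<dots> = (\<Sum>j\<in>I. of_int (\<Sum>u\<in>U. M s l u i0 j * c u) * v j)"
      by (subst sum.swap) (simp add: sum_distrib_right)
    also have "\<dots> = 0"
    proof (rule sum.neutral, rule ballI)
      fix j assume "j \<in> I"
      then show "of_int (\<Sum>u\<in>U. M s l u i0 j * c u) * v j = 0"
        using c(3)[of "((s, l), j)"] that by (simp add: E_def)
    qed
    finally show ?thesis using q i0 by simp
  qed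
  \<comment> \<open>Already at the point 1 not all derivatives vanish: otherwise all power sums with
    the distinct nodes \<open>w u\<close> would, and so would every \<open>c u\<close>.\<close>
  have "\<exists>s. S s 1 \<noteq> 0"
  proof (rule ccontr)
    assume "\<nexists>s. S s 1 \<noteq> 0"
    then have "(\<Sum>u\<in>U. (of_int (c u) * e u) * w u ^ s) = 0" for s
      by (simp add: S_def mult_ac)
    then have "of_int (c u) * e u = 0" if "u \<in> U" for u
      using power_sums_eq_0_imp_coeff_eq_0[OF finU _ _ that, of w "\<lambda>u. of_int (c u) * e u"]
        inj_on_nat_linear_form[OF irr, of U] unfolding w_def by blast
    then show False using c(1) ene by auto
  qed
  then have ex: "\<exists>s. \<exists>l\<in>{1..m}. S s l \<noteq> 0" using m by (auto intro!: bexI[of _ 1])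
  define r where "r = (LEAST s. \<exists>l\<in>{1..m}. S s l \<noteq> 0)"
  obtain l where l: "l \<in> {1..m}" "S r l \<noteq> 0" using LeastI_ex[OF ex] unfolding r_def by blast
  have least: "S s k = 0" if "s < r" "k \<in> {1..m}" for s k
    using not_less_Least[of s "\<lambda>s. \<exists>l\<in>{1..m}. S s l \<noteq> 0"] that unfolding r_def by blast
  have "n \<le> r" using S0 l by (meson not_le)
  \<comment> \<open>Number of terms, times coefficient bound, times row-sum bound of a term.\<close>
  define W where "W = N ^ 2 * X * G r"
  have lower: "1 \<le> cmod (of_nat q ^ (r + 2 * N * m) * S r l) * real W ^ card I"
  proof (rule int_rep_lower_bound[where v = v, OF _ fin i0])
    have cX: "int_rep I v (real X) (of_int (c u))" if "u \<in> U" for u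
    proof (rule int_rep_mono[OF int_rep_of_int[OF fin]])
      have "real_of_int \<bar>c u\<bar> \<le> real_of_int (int X)"
        using c(2)[OF that] unfolding X of_int_le_iff .
      then show "\<bar>real_of_int (c u)\<bar> \<le> real X" by simp
    qed
    have "int_rep I v (\<Sum>u\<in>U. real X * real (G r))
        (\<Sum>u\<in>U. of_int (c u) * (of_nat q ^ (r + 2 * N * m) * (w u ^ r * e u ^ l)))"
      using l by (intro int_rep_sum[OF fin finU] int_rep_mult cX term_rep) auto
    then show "int_rep I v (real W) (of_nat q ^ (r + 2 * N * m) * S r l)"
      by (simp add: S_def W_def cardU sum_distrib_left mult_ac)
    show "of_nat q ^ (r + 2 * N * m) * S r l \<noteq> 0" using l q by simp
    have "0 < W" using N(1) H by (simp add: W_def X_def G_def)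
    then show "1 \<le> real W" by simp
  qed
  define f where "f z = (\<Sum>u\<in>U. of_int (c u) * exp ((w u * t) * z))" for z
  have fd: "(deriv ^^ s) f (of_nat k) = t ^ s * S s k" for s k
  proof -
    have "exp (w u * t * of_nat k) = e u ^ k" for u
      by (simp add: w_def e_def exps exp_add[symmetric] exp_of_nat_mult[symmetric] algebra_simps)
    then show ?thesis
      unfolding f_def higher_deriv_exp_sum S_def
      by (simp add: sum_distrib_left power_mult_distrib mult_ac)
  qed
  have upper: "cmod ((deriv ^^ r) f (of_nat l)) \<le>
      fact r * (real (N ^ 2 * X) * exp (N * ((1 + cmod \<beta>) * cmod t) * R)) * ((4 * real m / R) ^ m) ^ r"
    if R: "2 * real m \<le> R" for R
  proof -
    have card: "card (of_nat ` {1..m} :: complex set) = m"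
      by (simp add: card_image inj_on_def)
    have "cmod ((deriv ^^ r) f (of_nat l)) \<le>
      fact r * (real (N ^ 2 * X) * exp (N * ((1 + cmod \<beta>) * cmod t) * R)) *
        ((4 * real m / R) ^ card (of_nat ` {1..m} :: complex set)) ^ r"
    proof (rule schwarz_higher_deriv_bound)
      show "f holomorphic_on UNIV" unfolding f_def by (intro holomorphic_intros)
      show "finite (of_nat ` {1..m} :: complex set)" by simp
      show "of_nat l \<in> (of_nat ` {1..m} :: complex set)" using l by blast
      show "(deriv ^^ s) f k = 0" if "k \<in> of_nat ` {1..m}" "s < r" for s k
        using that least by (auto simp: fd)
      show "1 \<le> real m" using m by simp
      show "cmod k \<le> real m" if "k \<in> of_nat ` {1..m}" for k using that by auto
      show "2 * real m \<le> R" by fact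
      fix z :: complex assume z: "cmod z = R"
      have "cmod (f z) \<le> (\<Sum>u\<in>U. real X * exp (N * ((1 + cmod \<beta>) * cmod t) * R))"
        unfolding f_def
      proof (rule sum_norm_le)
        fix u assume u: "u \<in> U"
        have "cmod (w u) \<le> real (fst u) + real (snd u) * cmod \<beta>"
          unfolding w_def by (rule norm_triangle_le) (simp add: norm_mult)
        also have "\<dots> \<le> real N + real N * cmod \<beta>"
          using u by (intro add_mono mult_right_mono) (auto simp: U_def)
        finally have "cmod (w u) \<le> real N * (1 + cmod \<beta>)" by (simp add: algebra_simps)
        then have "cmod (w u * t * z) \<le> real N * (1 + cmod \<beta>) * cmod t * R"
          unfolding norm_mult z by (intro mult_right_mono) (use z in auto)
        then have "cmod (exp (w u * t * z)) \<le> exp (N * ((1 + cmod \<beta>) * cmod t) * R)"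
          by (intro order_trans[OF norm_exp]) (simp add: mult.assoc)
        moreover have "cmod (of_int (c u)) \<le> real X"
        proof -
          have "real_of_int \<bar>c u\<bar> \<le> real_of_int (int X)"
            using c(2)[OF u] unfolding X of_int_le_iff .
          then show ?thesis by simp
        qed
        ultimately show "cmod (of_int (c u) * exp (w u * t * z)) \<le> real X * exp (N * ((1 + cmod \<beta>) * cmod t) * R)"
          unfolding norm_mult by (intro mult_mono) auto
      qed
      then show "cmod (f z) \<le> real (N ^ 2 * X) * exp (N * ((1 + cmod \<beta>) * cmod t) * R)"
        by (simp add: cardU)
    qed
    then show ?thesis unfolding card by simp
  qed
  show ?thesis
  proof (rule that[OF \<open>n \<le> r\<close>])
    fix R assume R: "2 * real m \<le> R"
    let ?B = "fact r * (real (N ^ 2 * X) * exp (N * ((1 + cmod \<beta>) * cmod t) * R)) * ((4 * real m / R) ^ m) ^ r"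
    have "cmod t ^ r \<le> cmod t ^ r * (cmod (of_nat q ^ (r + 2 * N * m) * S r l) * real W ^ card I)"
      using mult_left_mono[OF lower, of "cmod t ^ r"] by simp
    also have "\<dots> = real q ^ (r + 2 * N * m) * cmod ((deriv ^^ r) f (of_nat l)) * real W ^ card I"
      by (simp add: fd norm_mult norm_power mult_ac)
    also have "\<dots> \<le> real q ^ (r + 2 * N * m) * ?B * real W ^ card I"
      by (intro mult_right_mono mult_left_mono upper[OF R]) auto
    finally show "cmod t ^ r \<le> real q ^ (r + 2 * N * m) * ?B *
       real (N ^ 2 * X * ((2 * N * H) ^ r * H ^ (2 * N * m))) ^ card I"
      by (simp add: W_def G_def)
  qed
qed

section \<open>Choice of parameters and growth estimates\<close>

text \<open>The radius is now \<open>sqrt r\<close>. Up to constants, the \<open>r\<close>-th root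
  of the left-hand side is at most \<open>r ^ (d + 2)\<close> divided by
  \<open>r ^ (m / 2) = r ^ (d + 3)\<close>, that is, 1 / \<open>r\<close>, which drops below \<tau>
  because \<open>r\<close> is at least the large number \<open>k\<close>.\<close>

lemma gelfond_parameters_contradiction:
  fixes d q H k r :: nat and T \<tau> :: real
  defines "m \<equiv> 2 * (d + 3)"
  defines "N \<equiv> 2 * d * m * k" and "n \<equiv> 2 * d * m * k ^ 2"
  defines "C1 \<equiv> 16 * (4 * (2 * d * m) ^ 2 * H ^ 2) * H ^ (4 * m)"
  defines "X \<equiv> N ^ 2 * ((2 * N * H) ^ n * H ^ (2 * N * m))"
  assumes pos: "0 < d" "0 < q" "0 < H" "0 \<le> T" "0 < \<tau>" and r: "n \<le> r"
    and k: "2 * m \<le> k"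
      "real q ^ (1 + 2 * m) * real C1 ^ (d + 1) * exp (real (2 * d * m) * T) * (4 * real m) ^ m < \<tau> * real k"
  shows "real q ^ (r + 2 * N * m) *
       (fact r * (real (N ^ 2 * X) * exp (real N * T * sqrt r)) * ((4 * real m / sqrt r) ^ m) ^ r) *
       real (N ^ 2 * X * ((2 * N * H) ^ r * H ^ (2 * N * m))) ^ d < \<tau> ^ r"
proof -
  have m: "0 < m" by (simp add: m_def)
  have k0: "0 < k" using k(1) m by simp
  have dm: "0 < 2 * d * m" using pos m by simp
  have "k ^ 2 \<le> n" unfolding n_def using dm by simp
  then have kr: "k ^ 2 \<le> r" using r by simp
  have "k \<le> k ^ 2" using k0 by (simp add: power2_eq_square)
  then have "k \<le> r" using kr by simp
  then have r0: "0 < r" using k0 by simp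
  have "N \<le> n" unfolding N_def n_def using \<open>k \<le> k ^ 2\<close> by (rule mult_le_mono2)
  then have Nr: "N \<le> r" using r by simp
  \<comment> \<open>\<open>N\<close> is only of the order of \<open>sqrt r\<close>; hence the power
    \<open>(2 * N * H) ^ (2 * r)\<close> contributes just one factor \<open>r ^ r\<close>.\<close>
  have N2: "N ^ 2 \<le> (2 * d * m) ^ 2 * r"
    unfolding N_def power_mult_distrib[of _ k] using kr by (rule mult_le_mono2)
  have N0: "0 < N" using dm k0 by (simp add: N_def)
  have NH: "1 \<le> 2 * N * H" using N0 pos(3) by (simp add: Suc_le_eq)
  \<comment> \<open>\<open>W\<close> contains \<open>N ^ 2\<close> directly and once more inside
    \<open>X\<close>; this polynomial factor is absorbed into a constant to the power
    \<open>r\<close>.\<close>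
  have N4: "N ^ 4 \<le> 16 ^ r"
  proof -
    have "N \<le> 2 ^ r" using Nr less_exp[of r] by linarith
    then have "N ^ 4 \<le> (2 ^ r) ^ 4" by (rule power_mono) simp
    also have "\<dots> = (2 ^ 4) ^ r" by (simp only: power_mult[symmetric] mult.commute)
    finally show ?thesis by simp
  qed
  define W where "W = N ^ 2 * X * ((2 * N * H) ^ r * H ^ (2 * N * m))"
  have W: "W \<le> (C1 * r) ^ r"
  proof -
    have "(2 * N * H) ^ n * (2 * N * H) ^ r \<le> (2 * N * H) ^ (2 * r)"
      unfolding power_add[symmetric] using NH r by (intro power_increasing) auto
    also have "\<dots> = ((2 * N * H) ^ 2) ^ r" by (rule power_mult)
    also have "(2 * N * H) ^ 2 = 4 * H ^ 2 * N ^ 2" by (simp add: power_mult_distrib)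
    also have "(4 * H ^ 2 * N ^ 2) ^ r \<le> (4 * H ^ 2 * ((2 * d * m) ^ 2 * r)) ^ r"
      using N2 by (intro power_mono mult_le_mono2) auto
    finally have 1: "(2 * N * H) ^ n * (2 * N * H) ^ r \<le> (4 * H ^ 2 * ((2 * d * m) ^ 2 * r)) ^ r" .
    have "2 * N * m + 2 * N * m \<le> 4 * m * r" using Nr by simp
    then have "H ^ (2 * N * m) * H ^ (2 * N * m) \<le> H ^ (4 * m * r)"
      unfolding power_add[symmetric] using pos(3) by (intro power_increasing) auto
    also have "\<dots> = (H ^ (4 * m)) ^ r" by (simp add: power_mult)
    finally have 2: "H ^ (2 * N * m) * H ^ (2 * N * m) \<le> (H ^ (4 * m)) ^ r" .
    have "W = N ^ 4 * ((2 * N * H) ^ n * (2 * N * H) ^ r) * (H ^ (2 * N * m) * H ^ (2 * N * m))"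
      by (simp add: W_def X_def power2_eq_square power4_eq_xxxx mult_ac)
    also have "\<dots> \<le> 16 ^ r * (4 * H ^ 2 * ((2 * d * m) ^ 2 * r)) ^ r * (H ^ (4 * m)) ^ r"
      by (intro mult_le_mono N4 1 2)
    also have "\<dots> = (C1 * r) ^ r"
      by (simp add: C1_def power_mult_distrib[symmetric] mult_ac)
    finally show ?thesis .
  qed
  have "1 \<le> (2 * N * H) ^ r * H ^ (2 * N * m)" using NH pos(3) by (simp add: Suc_le_eq)
  \<comment> \<open>A crude estimate that lets the bound for \<open>W\<close> serve for the
    coefficients too.\<close>
  then have "N ^ 2 * X \<le> W" unfolding W_def by (metis mult.right_neutral mult_le_mono2)
  then have NX: "N ^ 2 * X \<le> (C1 * r) ^ r" using W by simp
  define s where "s = sqrt r"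
  have s0: "0 < s" using r0 by (simp add: s_def)
  have s2: "s ^ 2 = r" by (simp add: s_def)
  have ks: "real k \<le> s"
    unfolding s_def by (rule real_le_rsqrt) (use kr in \<open>metis of_nat_le_iff of_nat_power\<close>)
  \<comment> \<open>this beats the \<open>d + 2\<close> powers of \<open>r\<close> coming from \<open>fact r\<close>, \<open>N ^ 2 * X\<close> and \<open>W ^ d\<close>\<close>
  have sm: "s ^ m = real r ^ (d + 3)" by (simp only: m_def power_mult s2)
  have f1: "real q ^ (r + 2 * N * m) \<le> (real q ^ (1 + 2 * m)) ^ r"
  proof -
    have "r + 2 * N * m \<le> (1 + 2 * m) * r" using Nr by (simp add: algebra_simps)
    then have "real q ^ (r + 2 * N * m) \<le> real q ^ ((1 + 2 * m) * r)"
      using pos(2) by (intro power_increasing) auto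
    then show ?thesis unfolding power_mult[of _ "1 + 2 * m"] .
  qed
  have f2: "(fact r :: real) \<le> real r ^ r" by (metis fact_le_power le_refl of_nat_fact of_nat_mono of_nat_power)
  have f3: "real (N ^ 2 * X) \<le> (real C1 * real r) ^ r"
    using NX by (metis of_nat_le_iff of_nat_mult of_nat_power)
  \<comment> \<open>Since \<open>k\<close> \<le> \<open>s\<close>, the product \<open>N * s\<close>
    is at most a constant times \<open>r\<close>: the growth of the exponentials on the circle costs
    only a constant to the power \<open>r\<close>.\<close>
  have f4: "exp (real N * T * s) \<le> exp (real (2 * d * m) * T) ^ r"
  proof -
    have "real N * s \<le> real (2 * d * m) * (s * s)"
      unfolding N_def of_nat_mult[of _ k] using ks s0 by (simp add: mult_left_mono mult_right_mono)
    then have "real N * s * T \<le> real (2 * d * m) * (s * s) * T" using pos(4) by (rule mult_right_mono)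
    then have "real N * T * s \<le> real r * (real (2 * d * m) * T)"
      unfolding s2[unfolded power2_eq_square] by (simp add: mult_ac)
    then show ?thesis by (simp only: exp_of_nat_mult[symmetric] exp_le_cancel_iff)
  qed
  have f5: "(4 * real m / s) ^ m = (4 * real m) ^ m / real r ^ (d + 3)"
    by (simp add: power_divide sm)
  have f6: "real W ^ d \<le> ((real C1 * real r) ^ d) ^ r"
  proof -
    have "real W \<le> (real C1 * real r) ^ r"
      using W by (metis of_nat_le_iff of_nat_mult of_nat_power)
    then have "real W ^ d \<le> ((real C1 * real r) ^ r) ^ d" by (rule power_mono) simp
    then show ?thesis by (simp only: power_mult[symmetric] mult.commute)
  qed
  define B where "B = real q ^ (1 + 2 * m) * real C1 ^ (d + 1) * exp (real (2 * d * m) * T) * (4 * real m) ^ m"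
  have "real q ^ (r + 2 * N * m) *
       (fact r * (real (N ^ 2 * X) * exp (real N * T * s)) * ((4 * real m / s) ^ m) ^ r) * real W ^ d
     \<le> (real q ^ (1 + 2 * m)) ^ r *
       (real r ^ r * ((real C1 * real r) ^ r * exp (real (2 * d * m) * T) ^ r) *
         ((4 * real m) ^ m / real r ^ (d + 3)) ^ r) * ((real C1 * real r) ^ d) ^ r"
    unfolding f5 by (intro mult_mono f1 f2 f3 f4 f6 order_refl) (auto intro!: mult_nonneg_nonneg)
  \<comment> \<open>All factors are gathered under a single \<open>r\<close>-th power, so that only
    the bases need comparing.\<close>
  also have "\<dots> = (real q ^ (1 + 2 * m) * (real r * (real C1 * real r * exp (real (2 * d * m) * T)) *
      ((4 * real m) ^ m / real r ^ (d + 3))) * (real C1 * real r) ^ d) ^ r"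
    by (simp only: power_mult_distrib[symmetric])
  also have "real q ^ (1 + 2 * m) * (real r * (real C1 * real r * exp (real (2 * d * m) * T)) *
      ((4 * real m) ^ m / real r ^ (d + 3))) * (real C1 * real r) ^ d =
      B * (real r ^ (d + 2) / real r ^ (d + 3))"
    unfolding B_def power_mult_distrib[of "real C1"] power_add[of "real C1"] power_add[of "real r" d 2]
    by (simp only: power2_eq_square power_one_right times_divide_eq_left times_divide_eq_right mult_ac)
  also have "real r ^ (d + 2) / real r ^ (d + 3) = 1 / real r"
    using r0 by (simp add: field_simps power_add eval_nat_numeral)
  also have "(B * (1 / real r)) ^ r < \<tau> ^ r"
  proof (rule power_strict_mono)
    have "B < \<tau> * real k" using k(2) by (simp add: B_def)
    also have "\<dots> \<le> \<tau> * real r" using \<open>k \<le> r\<close> pos(5) by simp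
    finally show "B * (1 / real r) < \<tau>" using r0 by (simp add: divide_less_eq)
    show "0 \<le> B * (1 / real r)" by (simp add: B_def)
  qed (use r0 in auto)
  finally show ?thesis unfolding W_def s_def .
qed

text \<open>The order of choices matters: the matrix size \<open>d\<close> depends only on the three
  algebraic numbers, \<open>m\<close> on \<open>d\<close>, and \<open>k\<close> is taken large after
  all constants; \<open>N\<close> and \<open>n\<close> then satisfy the counting equation, and
  \<open>r\<close> comes last.\<close>

theorem gelfond_schneider:
  fixes \<beta> t :: complex
  assumes "t \<noteq> 0" "algebraic (exp t)" "algebraic \<beta>" "\<beta> \<notin> \<rat>"
  shows "\<not> algebraic (exp (\<beta> * t))"
proof
  assume "algebraic (exp (\<beta> * t))"
  then obtain I :: "((nat \<times> nat) \<times> nat) set" and v i0 and q :: nat and H' :: real where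
    I: "finite I" "i0 \<in> I" "v i0 \<noteq> 0" and q: "0 < q" "real q \<le> H'"
    and reps: "int_rep I v H' (of_nat q * exp t)" "int_rep I v H' (of_nat q * \<beta>)"
      "int_rep I v H' (of_nat q * exp (\<beta> * t))"
    using algebraic3_int_rep[OF assms(2,3)] by metis
  define H where "H = nat \<lceil>H'\<rceil>"
  have H': "H' \<le> real H" unfolding H_def by linarith
  note reps = reps[THEN int_rep_mono[OF _ H']]
  have qH: "q \<le> H" using q(2) H' by linarith
  then have H: "0 < H" using q by simp
  define d where "d = card I"
  have d: "0 < d" using I by (auto simp: d_def card_gt_0_iff)
  define m where "m = 2 * (d + 3)"
  define T where "T = (1 + cmod \<beta>) * cmod t"
  define C1 where "C1 = 16 * (4 * (2 * d * m) ^ 2 * H ^ 2) * H ^ (4 * m)"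
  define B where "B = real q ^ (1 + 2 * m) * real C1 ^ (d + 1) * exp (real (2 * d * m) * T) * (4 * real m) ^ m"
  obtain k0 :: nat where k0: "B / cmod t < real k0" using reals_Archimedean2 by blast
  \<comment> \<open>\<open>k0\<close> makes the final comparison of bases strict; the summand
    \<open>2 * m\<close> makes the radius \<open>sqrt r\<close> admissible, as \<open>r\<close>
    \<ge> \<open>n\<close> \<ge> \<open>k ^ 2\<close>.\<close>
  define k where "k = k0 + 2 * m"
  have "B / cmod t < real k" using k0 by (simp add: k_def)
  then have kB: "B < cmod t * real k" using assms(1) by (simp add: divide_less_eq mult.commute)
  have km: "2 * m \<le> k" "0 < m" by (simp_all add: k_def m_def)
  define N where "N = 2 * d * m * k"
  define n where "n = 2 * d * m * k ^ 2"
  have N0: "0 < N" using d km by (simp add: N_def)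
  have NN: "N * N = 2 * (n * m * card I)"
    by (simp add: N_def n_def d_def power2_eq_square)
  obtain r where r: "n \<le> r"
    "\<And>R. 2 * real m \<le> R \<Longrightarrow> cmod t ^ r \<le> real q ^ (r + 2 * N * m) *
       (fact r * (real (N ^ 2 * (N ^ 2 * ((2 * N * H) ^ n * H ^ (2 * N * m)))) *
          exp (N * ((1 + cmod \<beta>) * cmod t) * R)) * ((4 * real m / R) ^ m) ^ r) *
       real (N ^ 2 * (N ^ 2 * ((2 * N * H) ^ n * H ^ (2 * N * m))) * ((2 * N * H) ^ r * H ^ (2 * N * m))) ^ card I"
    using gelfond_auxiliary[OF I q(1) qH reps refl refl assms(4) N0 NN km(2)] by metis
  have "k ^ 2 \<le> n" using d km by (simp add: n_def)
  then have "(2 * m) ^ 2 \<le> r" using r(1) power_mono[OF km(1), of 2] by simp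
  then have "2 * real m \<le> sqrt r"
    by (intro real_le_rsqrt) (metis of_nat_le_iff of_nat_mult of_nat_numeral of_nat_power)
  from r(2)[OF this] show False
    using gelfond_parameters_contradiction[OF d q(1) H _ _ r(1)[unfolded n_def m_def] km(1)[unfolded m_def],
        of T "cmod t"] kB assms(1)
    unfolding T_def[symmetric] B_def C1_def N_def n_def m_def d_def[symmetric]
    by (simp add: T_def not_le)
qed

section \<open>Algebraic values of the infinite power tower\<close>

theorem theorem2p5:
  fixes t x :: complex
  assumes x_def: "x = exp (t * exp (- t))"
    and t_cond: "norm t < 1 \<or> (\<exists>n::nat. n > 0 \<and> t ^ n = 1)"
    and x_alg: "algebraic x"
    and h_alg: "algebraic (exp t)"
  shows "x \<in> \<real> \<and> Re x > 0"
proof -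
  have "norm t \<le> 1" using t_cond
  proof
    assume "\<exists>n::nat. n > 0 \<and> t ^ n = 1"
    then obtain n :: nat where "n > 0" "t ^ n = 1" by blast
    then have "norm t ^ n = 1" by (metis norm_one norm_power)
    with \<open>n > 0\<close> show ?thesis using power_eq_iff_eq_base[of n "norm t" 1] by simp
  qed simp
  then have "\<bar>Im t\<bar> < pi" using abs_Im_le_cmod[of t] pi_gt3 by linarith
  \<comment> \<open>The contrapositive of Gelfond--Schneider with exponent \<open>exp (- t)\<close>.
    The case \<open>t = 0\<close> lies outside that theorem, but there \<open>exp (- t) = 1\<close>
    is real anyway.\<close>
  have "exp (- t) \<in> \<rat>" if "t \<noteq> 0"
    using gelfond_schneider[OF that h_alg, of "exp (- t)"] x_alg algebraic_inverse[OF h_alg]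
    by (auto simp: x_def exp_minus mult.commute)
  then have "exp (- t) \<in> \<real>" by (cases "t = 0") (auto elim!: Rats_cases')
  \<comment> \<open>The imaginary part of \<open>exp (- t)\<close> is \<open>sin (Im t)\<close> up
    to a nonzero real factor.\<close>
  then have "sin (Im t) = 0" by (simp add: complex_is_Real_iff Im_exp)
  then have "Im t = 0"
    using \<open>\<bar>Im t\<bar> < pi\<close> sin_eq_0_pi[of "Im t"] by auto
  then have "t = of_real (Re t)" by (simp add: complex_eq_iff)
  then have "x = of_real (exp (Re t * exp (- Re t)))"
    unfolding x_def by (metis exp_of_real of_real_minus of_real_mult)
  then show ?thesis by simp
qed

end
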